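(* Let $\Bbbk$ be a subfield of $\mathbb{R}$ and let $\Bbbk_{\geq 0}$ be the semiring of all non-negative elements of $\Bbbk$. Then: (a) up to isomorphism, ${}_{\Bbbk_{\geq 0}}\mathbf{B}$ is the only simple $\Bbbk_{\geq 0}$-semimodule; (b) up to isomorphism, ${}_{\Bbbk_{\geq 0}}\Bbbk_{\geq 0}$ is the only minimal $\Bbbk_{\geq 0}$-semimodule which is not simple; (c) up to isomorphism, ${}_{\Bbbk_{\geq 0}}\Bbbk$ is the only elementary $\Bbbk_{\geq 0}$-semimodule which is not simple.
   Context: A semiring is a tuple $(R,+,\cdot,0,1)$ where $(R,+,0)$ is a commutative monoid, $(R,\cdot,1)$ is a monoid, multiplication distributes over addition on both sides, and $0a=a0=0$ for all $a\in R$. A (left) $R$-semimodule is a commutative monoid $(M,+,0_M)$ with a map $R\times M\to M$, $(r,m)\mapsto r(m)$, such that $r(m+n)=r(m)+r(n)$, $r(0_M)=0_M$, $(r+s)(m)=r(m)+s(m)$, $(rs)(m)=r(s(m))$, $0(m)=0_M$, $1(m)=m$. Homomorphisms of semimodules are monoid homomorphisms commuting with the action of $R$. A subsemimodule is a submonoid closed under the action of $R$. An $R$-congruence on $M$ is an equivalence relation $\sim$ such that $m\sim n$ implies $m+k\sim n+k$ for all $k\in M$ and $r(m)\sim r(n)$ for all $r\in R$. A non-zero $R$-semimodule $M$ is called minimal if its only subsemimodules are $\{0_M\}$ and $M$; elementary if its only $R$-congruences are the equality relation and the full relation $M\times M$; simple if it is both minimal and elementary. ${}_{\Bbbk_{\geq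 0}}\mathbf{B}$ is the monoid $(\{0,1\},+,0)$ with $1+1=1$, on which $0\in\Bbbk_{\geq 0}$ acts as zero and every non-zero element of $\Bbbk_{\geq 0}$ acts as the identity. ${}_{\Bbbk_{\geq 0}}\Bbbk_{\geq 0}$ is the left regular semimodule (the additive monoid of $\Bbbk_{\geq 0}$ with action by multiplication). ${}_{\Bbbk_{\geq 0}}\Bbbk$ is the additive group of $\Bbbk$ with $\Bbbk_{\geq 0}$ acting by multiplication. *)

theory Defs
  imports "HOL-Algebra.Module" "HOL-Algebra.Subrings" "HOL-Algebra.Algebraic_Closure_Type"
begin

text \<open>
  Semimodules are carried by the \<open>module\<close> record of HOL-Algebra. Of the fields of that record only
  \<open>carrier\<close>, \<open>zero\<close>, \<open>add\<close> and \<open>smult\<close> are used; the inherited fields \<open>mult\<close> and \<open>one\<close> are irrelevant.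
\<close>

locale semimodule = R?: semiring R + M?: abelian_monoid M
    for R (structure) and M :: "('a, 'b, 'c) module_scheme" (structure) +
  assumes smult_closed:
      "\<lbrakk>r \<in> carrier R; m \<in> carrier M\<rbrakk> \<Longrightarrow> r \<odot>\<^bsub>M\<^esub> m \<in> carrier M"
    and smult_r_distr:
      "\<lbrakk>r \<in> carrier R; m \<in> carrier M; n \<in> carrier M\<rbrakk> \<Longrightarrow>
         r \<odot>\<^bsub>M\<^esub> (m \<oplus>\<^bsub>M\<^esub> n) = r \<odot>\<^bsub>M\<^esub> m \<oplus>\<^bsub>M\<^esub> r \<odot>\<^bsub>M\<^esub> n"
    and smult_r_null:
      "r \<in> carrier R \<Longrightarrow> r \<odot>\<^bsub>M\<^esub> \<zero>\<^bsub>M\<^esub> = \<zero>\<^bsub>M\<^esub>"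
    and smult_l_distr:
      "\<lbrakk>r \<in> carrier R; s \<in> carrier R; m \<in> carrier M\<rbrakk> \<Longrightarrow>
         (r \<oplus>\<^bsub>R\<^esub> s) \<odot>\<^bsub>M\<^esub> m = r \<odot>\<^bsub>M\<^esub> m \<oplus>\<^bsub>M\<^esub> s \<odot>\<^bsub>M\<^esub> m"
    and smult_assoc:
      "\<lbrakk>r \<in> carrier R; s \<in> carrier R; m \<in> carrier M\<rbrakk> \<Longrightarrow>
         (r \<otimes>\<^bsub>R\<^esub> s) \<odot>\<^bsub>M\<^esub> m = r \<odot>\<^bsub>M\<^esub> (s \<odot>\<^bsub>M\<^esub> m)"
    and smult_l_null:
      "m \<in> carrier M \<Longrightarrow> \<zero>\<^bsub>R\<^esub> \<odot>\<^bsub>M\<^esub> m = \<zero>\<^bsub>M\<^esub>"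
    and smult_one:
      "m \<in> carrier M \<Longrightarrow> \<one>\<^bsub>R\<^esub> \<odot>\<^bsub>M\<^esub> m = m"

definition semimodule_hom ::
  "('a, 'r) ring_scheme \<Rightarrow> ('a, 'b, 'm) module_scheme \<Rightarrow> ('a, 'c, 'n) module_scheme \<Rightarrow> ('b \<Rightarrow> 'c) set"
  where "semimodule_hom R M N =
    {f. f \<in> carrier M \<rightarrow> carrier N \<and>
        f \<zero>\<^bsub>M\<^esub> = \<zero>\<^bsub>N\<^esub> \<and>
        (\<forall>m \<in> carrier M. \<forall>n \<in> carrier M. f (m \<oplus>\<^bsub>M\<^esub> n) = f m \<oplus>\<^bsub>N\<^esub> f n) \<and>
        (\<forall>r \<in> carrier R. \<forall>m \<in> carrier M. f (r \<odot>\<^bsub>M\<^esub> m) = r \<odot>\<^bsub>N\<^esub> f m)}"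

definition semimodule_isomorphic ::
  "('a, 'r) ring_scheme \<Rightarrow> ('a, 'b, 'm) module_scheme \<Rightarrow> ('a, 'c, 'n) module_scheme \<Rightarrow> bool"
  where "semimodule_isomorphic R M N \<longleftrightarrow>
    (\<exists>f \<in> semimodule_hom R M N. bij_betw f (carrier M) (carrier N))"

definition subsemimodule ::
  "'b set \<Rightarrow> ('a, 'r) ring_scheme \<Rightarrow> ('a, 'b, 'm) module_scheme \<Rightarrow> bool"
  where "subsemimodule N R M \<longleftrightarrow>
    submonoid N (add_monoid M) \<and> (\<forall>r \<in> carrier R. \<forall>n \<in> N. r \<odot>\<^bsub>M\<^esub> n \<in> N)"

definition semimodule_congruence ::
  "('b \<times> 'b) set \<Rightarrow> ('a, 'r) ring_scheme \<Rightarrow> ('a, 'b, 'm) module_scheme \<Rightarrow> bool"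
  where "semimodule_congruence E R M \<longleftrightarrow>
    equiv (carrier M) E \<and>
    (\<forall>(m, n) \<in> E. (\<forall>k \<in> carrier M. (m \<oplus>\<^bsub>M\<^esub> k, n \<oplus>\<^bsub>M\<^esub> k) \<in> E) \<and>
                   (\<forall>r \<in> carrier R. (r \<odot>\<^bsub>M\<^esub> m, r \<odot>\<^bsub>M\<^esub> n) \<in> E))"

definition minimal_semimodule ::
  "('a, 'r) ring_scheme \<Rightarrow> ('a, 'b, 'm) module_scheme \<Rightarrow> bool"
  where "minimal_semimodule R M \<longleftrightarrow>
    semimodule R M \<and> carrier M \<noteq> {\<zero>\<^bsub>M\<^esub>} \<and>
    (\<forall>N. subsemimodule N R M \<longrightarrow> N = {\<zero>\<^bsub>M\<^esub>} \<or> N = carrier M)"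

definition elementary_semimodule ::
  "('a, 'r) ring_scheme \<Rightarrow> ('a, 'b, 'm) module_scheme \<Rightarrow> bool"
  where "elementary_semimodule R M \<longleftrightarrow>
    semimodule R M \<and> carrier M \<noteq> {\<zero>\<^bsub>M\<^esub>} \<and>
    (\<forall>E. semimodule_congruence E R M \<longrightarrow> E = Id_on (carrier M) \<or> E = carrier M \<times> carrier M)"

definition simple_semimodule ::
  "('a, 'r) ring_scheme \<Rightarrow> ('a, 'b, 'm) module_scheme \<Rightarrow> bool"
  where "simple_semimodule R M \<longleftrightarrow> minimal_semimodule R M \<and> elementary_semimodule R M"

definition nonneg_semiring :: "real set \<Rightarrow> real ring"
  where "nonneg_semiring K = ring_of_type_algebra\<lparr>carrier := {x \<in> K. 0 \<le> x}\<rparr>"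

text \<open>The monoid $\{0,1\}$ with $1+1=1$ is realised on \<open>bool\<close>, with \<open>False\<close> as $0$ and \<open>True\<close> as $1$.\<close>

definition boolean_semimodule :: "(real, bool) module"
  where "boolean_semimodule =
    \<lparr>carrier = UNIV, monoid.mult = undefined, one = undefined,
     zero = False, add = (\<or>), module.smult = (\<lambda>r b. if r = 0 then False else b)\<rparr>"

definition regular_semimodule :: "'a ring \<Rightarrow> ('a, 'a) module"
  where "regular_semimodule R =
    \<lparr>carrier = carrier R, monoid.mult = monoid.mult R, one = one R,
     zero = zero R, add = add R, module.smult = monoid.mult R\<rparr>"

definition field_semimodule :: "real set \<Rightarrow> (real, real) module"
  where "field_semimodule K =
    \<lparr>carrier = K, monoid.mult = (*), one = 1, zero = 0, add = (+), module.smult = (*)\<rparr>"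

end

theory Submission
  imports Defs
begin

text \<open>
  Write \<open>P\<close> for the semifield of non-negative elements of \<open>K\<close>. Both classifications rest on the fact
  that a non-zero \<open>P\<close>-semimodule with just two elements is \<open>\<^bold>B\<close> and is simple.

  A minimal semimodule is cyclic, \<open>M = P m\<close>. If \<open>r \<mapsto> r m\<close> is injective, then \<open>M\<close> is the regular
  semimodule. Otherwise \<open>c m = m\<close> for some \<open>c > 1\<close>. The stabiliser of \<open>m\<close> in \<open>P\<close> is convex, since
  \<open>a + b = 1\<close> makes \<open>(a g + b h) m = a m + b m = m\<close>; it is unbounded, since
  \<open>m + n (c - 1) m = m\<close> for all \<open>n\<close>; and it is closed under inverses. So it consists of all positive
  scalars, and \<open>M = {0, m}\<close> (\<open>stabiliser_all\<close>, \<open>minimal_cases\<close>). The Archimedean property of the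
  reals enters only in this step.

  For an elementary semimodule the congruence that identifies elements differing by an additive
  unit shows that \<open>M\<close> is a group or has no unit but \<open>0\<close>. In the second case the non-zero elements
  form one class of a congruence, so that \<open>M\<close> has two elements (\<open>elementary_cases\<close>). In the first
  case \<open>M\<close> is a \<open>K\<close>-vector space whose quotients are all trivial, hence a line
  (\<open>elementary_group_iso_field\<close>).

  A minimal semimodule is never a group, because \<open>- m = r m\<close> would give \<open>(1 + r) m = 0\<close> with
  \<open>1 + r\<close> invertible. Hence a simple semimodule has two elements, and the two classifications
  give the three parts of the theorem.
\<close>

section \<open>The semifield of non-negative elements\<close>

locale real_subfield =
  fixes K :: "real set"
  assumes subfield_K: "subfield K ring_of_type_algebra"
begin

lemma zero_mem [simp]: "0 \<in> K"
  and one_mem [simp]: "1 \<in> K"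
  and add_mem [simp]: "x \<in> K \<Longrightarrow> y \<in> K \<Longrightarrow> x + y \<in> K"
  and mult_mem [simp]: "x \<in> K \<Longrightarrow> y \<in> K \<Longrightarrow> x * y \<in> K"
  and uminus_mem [simp]: "x \<in> K \<Longrightarrow> - x \<in> K"
proof -
  interpret T: ring "ring_of_type_algebra :: real ring" by (rule ring_from_type_algebra)
  interpret S: subring K ring_of_type_algebra
    using subfieldE(1)[OF subfield_K] .
  note [simp] = ring_of_type_algebra_def
  show "0 \<in> K" "1 \<in> K" using subringE(2,3)[OF S.subring_axioms] by simp_all
  show "x \<in> K \<Longrightarrow> y \<in> K \<Longrightarrow> x + y \<in> K" "x \<in> K \<Longrightarrow> y \<in> K \<Longrightarrow> x * y \<in> K"
    using subringE(6,7)[OF S.subring_axioms, of x y] by simp_all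
  assume x: "x \<in> K"
  let ?y = "\<ominus>\<^bsub>ring_of_type_algebra\<^esub> x"
  have "x \<oplus>\<^bsub>ring_of_type_algebra\<^esub> ?y = \<zero>\<^bsub>ring_of_type_algebra\<^esub>"
    by (rule T.r_neg) simp
  then have "?y = - x" by simp
  then show "- x \<in> K" using subringE(5)[OF S.subring_axioms x] by simp
qed

lemma diff_mem [simp]: "x \<in> K \<Longrightarrow> y \<in> K \<Longrightarrow> x - y \<in> K"
  using add_mem[of x "- y"] by simp

lemma inverse_mem [simp]: "x \<in> K \<Longrightarrow> inverse x \<in> K"
proof (cases "x = 0")
  case False
  assume "x \<in> K"
  with False have "x \<in> Units (ring_of_type_algebra\<lparr>carrier := K\<rparr>)"
    using subfield.subfield_Units[OF subfield_K] by (simp add: ring_of_type_algebra_def)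
  then obtain y where "y \<in> K" "x * y = 1"
    by (auto simp: Units_def ring_of_type_algebra_def)
  then show ?thesis using inverse_unique by metis
qed simp

lemma divide_mem [simp]: "x \<in> K \<Longrightarrow> y \<in> K \<Longrightarrow> x / y \<in> K"
  by (simp add: divide_inverse)

lemma of_nat_mem [simp]: "of_nat n \<in> K"
  by (induction n) simp_all

lemma nonneg_semiring_simps [simp]:
  "carrier (nonneg_semiring K) = {x \<in> K. 0 \<le> x}"
  "x \<oplus>\<^bsub>nonneg_semiring K\<^esub> y = x + y" "x \<otimes>\<^bsub>nonneg_semiring K\<^esub> y = x * y"
  "\<zero>\<^bsub>nonneg_semiring K\<^esub> = 0" "\<one>\<^bsub>nonneg_semiring K\<^esub> = 1"
  by (simp_all add: nonneg_semiring_def ring_of_type_algebra_def)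

lemma semiring_nonneg: "semiring (nonneg_semiring K)"
  by unfold_locales (auto simp: algebra_simps)

end

section \<open>Semimodules over the non-negative elements\<close>

locale nonneg_semimodule = real_subfield K + semimodule "nonneg_semiring K" M
  for K :: "real set" and M :: "(real, 'b, 'c) module_scheme" (structure)
begin

lemma act_closed [simp]: "\<lbrakk>r \<in> K; 0 \<le> r; x \<in> carrier M\<rbrakk> \<Longrightarrow> r \<odot> x \<in> carrier M"
  using smult_closed by simp

lemma act_add_right:
  "\<lbrakk>r \<in> K; 0 \<le> r; x \<in> carrier M; y \<in> carrier M\<rbrakk> \<Longrightarrow> r \<odot> (x \<oplus> y) = r \<odot> x \<oplus> r \<odot> y"
  using smult_r_distr by simp

lemma act_zero_right [simp]: "\<lbrakk>r \<in> K; 0 \<le> r\<rbrakk> \<Longrightarrow> r \<odot> \<zero> = \<zero>"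
  using smult_r_null by simp

lemma act_add_left:
  "\<lbrakk>r \<in> K; 0 \<le> r; s \<in> K; 0 \<le> s; x \<in> carrier M\<rbrakk> \<Longrightarrow> (r + s) \<odot> x = r \<odot> x \<oplus> s \<odot> x"
  using smult_l_distr by simp

lemma act_mult:
  "\<lbrakk>r \<in> K; 0 \<le> r; s \<in> K; 0 \<le> s; x \<in> carrier M\<rbrakk> \<Longrightarrow> (r * s) \<odot> x = r \<odot> (s \<odot> x)"
  using smult_assoc by simp

lemma act_zero_left [simp]: "x \<in> carrier M \<Longrightarrow> 0 \<odot> x = \<zero>"
  using smult_l_null by simp

lemma act_one [simp]: "x \<in> carrier M \<Longrightarrow> 1 \<odot> x = x"
  using smult_one by simp

lemma act_inverse [simp]:
  assumes "r \<in> K" "0 < r" "x \<in> carrier M"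
  shows "inverse r \<odot> (r \<odot> x) = x" "r \<odot> (inverse r \<odot> x) = x"
  using assms act_mult[of "inverse r" r x] act_mult[of r "inverse r" x] by simp_all

lemma act_eq_zero_iff:
  assumes "r \<in> K" "0 < r" "x \<in> carrier M"
  shows "r \<odot> x = \<zero> \<longleftrightarrow> x = \<zero>"
proof
  assume "r \<odot> x = \<zero>"
  then have "inverse r \<odot> (r \<odot> x) = \<zero>" using assms by simp
  then show "x = \<zero>" using assms by simp
qed (use assms in simp)

lemma subsemimoduleI:
  assumes "N \<subseteq> carrier M" "\<zero> \<in> N" "\<And>x y. \<lbrakk>x \<in> N; y \<in> N\<rbrakk> \<Longrightarrow> x \<oplus> y \<in> N"
    and "\<And>r x. \<lbrakk>r \<in> K; 0 \<le> r; x \<in> N\<rbrakk> \<Longrightarrow> r \<odot> x \<in> N"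
  shows "subsemimodule N (nonneg_semiring K) M"
  using assms unfolding subsemimodule_def by (auto intro!: submonoid.intro)

lemma subsemimoduleD:
  assumes "subsemimodule N (nonneg_semiring K) M"
  shows "N \<subseteq> carrier M" "\<zero> \<in> N" "\<And>r x. \<lbrakk>r \<in> K; 0 \<le> r; x \<in> N\<rbrakk> \<Longrightarrow> r \<odot> x \<in> N"
  using assms submonoid.subset submonoid.one_closed
  unfolding subsemimodule_def by fastforce+

lemma semimodule_congruenceI:
  fixes Q
  defines "E \<equiv> {(x, y). x \<in> carrier M \<and> y \<in> carrier M \<and> Q x y}"
  assumes "\<And>x. x \<in> carrier M \<Longrightarrow> Q x x"
    and "\<And>x y. \<lbrakk>x \<in> carrier M; y \<in> carrier M; Q x y\<rbrakk> \<Longrightarrow> Q y x"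
    and "\<And>x y z. \<lbrakk>x \<in> carrier M; y \<in> carrier M; z \<in> carrier M; Q x y; Q y z\<rbrakk> \<Longrightarrow> Q x z"
    and "\<And>x y k. \<lbrakk>x \<in> carrier M; y \<in> carrier M; k \<in> carrier M; Q x y\<rbrakk> \<Longrightarrow> Q (x \<oplus> k) (y \<oplus> k)"
    and "\<And>x y r. \<lbrakk>x \<in> carrier M; y \<in> carrier M; r \<in> K; 0 < r; Q x y\<rbrakk> \<Longrightarrow> Q (r \<odot> x) (r \<odot> y)"
  shows "semimodule_congruence E (nonneg_semiring K) M"
proof -
  have "equiv (carrier M) E"
    unfolding E_def equiv_def refl_on_def sym_def trans_def using assms(2-4) by blast
  moreover have "Q (r \<odot> x) (r \<odot> y)"
    if "x \<in> carrier M" "y \<in> carrier M" "Q x y" "r \<in> K" "0 \<le> r" for x y r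
    using that assms(2)[of \<zero>] assms(6)[of x y r] by (cases "r = 0") auto
  ultimately show ?thesis
    unfolding semimodule_congruence_def E_def using assms(5) by auto
qed

lemma elementary_congruence_cases:
  assumes "elementary_semimodule (nonneg_semiring K) M"
    and "semimodule_congruence {(x, y). x \<in> carrier M \<and> y \<in> carrier M \<and> Q x y} (nonneg_semiring K) M"
  obtains (identity) "\<And>x y. \<lbrakk>x \<in> carrier M; y \<in> carrier M; Q x y\<rbrakk> \<Longrightarrow> x = y"
  | (total) "\<And>x y. \<lbrakk>x \<in> carrier M; y \<in> carrier M\<rbrakk> \<Longrightarrow> Q x y"
proof -
  let ?E = "{(x, y). x \<in> carrier M \<and> y \<in> carrier M \<and> Q x y}"
  have "?E = Id_on (carrier M) \<or> ?E = carrier M \<times> carrier M"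
    using assms unfolding elementary_semimodule_def by simp
  then show thesis
  proof
    assume E: "?E = Id_on (carrier M)"
    have "x = y" if "x \<in> carrier M" "y \<in> carrier M" "Q x y" for x y
    proof -
      have "(x, y) \<in> ?E" using that by simp
      then show ?thesis unfolding E by blast
    qed
    then show thesis by (rule identity)
  next
    assume E: "?E = carrier M \<times> carrier M"
    have "Q x y" if "x \<in> carrier M" "y \<in> carrier M" for x y
    proof -
      have "(x, y) \<in> ?E" unfolding E using that by simp
      then show ?thesis by simp
    qed
    then show thesis by (rule total)
  qed
qed

lemma nonzero_exists:
  assumes "carrier M \<noteq> {\<zero>}"
  obtains m where "m \<in> carrier M" "m \<noteq> \<zero>"
  using assms zero_closed by blast

section \<open>Two-element semimodules\<close>

lemma two_element_simple:
  assumes "carrier M = {\<zero>, m}" "m \<noteq> \<zero>"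
  shows "simple_semimodule (nonneg_semiring K) M"
proof -
  have "minimal_semimodule (nonneg_semiring K) M"
    unfolding minimal_semimodule_def
  proof (intro conjI allI impI)
    fix N assume "subsemimodule N (nonneg_semiring K) M"
    then show "N = {\<zero>} \<or> N = carrier M"
      using subsemimoduleD(1,2)[of N] assms by auto
  qed (use assms semimodule_axioms in auto)
  moreover have "elementary_semimodule (nonneg_semiring K) M"
    unfolding elementary_semimodule_def
  proof (intro conjI allI impI)
    fix E assume "semimodule_congruence E (nonneg_semiring K) M"
    then have E: "equiv (carrier M) E" unfolding semimodule_congruence_def by blast
    then have E': "refl_on (carrier M) E" "sym E" "E \<subseteq> carrier M \<times> carrier M"
      by (auto simp: equiv_def)
    show "E = Id_on (carrier M) \<or> E = carrier M \<times> carrier M"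
    proof (cases "(\<zero>, m) \<in> E")
      case True
      then have "(m, \<zero>) \<in> E" using E' by (auto dest: symD)
      then show ?thesis using True E' assms(1) by (auto simp: refl_on_def)
    next
      case False
      then have "(m, \<zero>) \<notin> E" using E' by (auto dest: symD)
      then show ?thesis using False E' assms(1) by (auto simp: refl_on_def)
    qed
  qed (use assms semimodule_axioms in auto)
  ultimately show ?thesis unfolding simple_semimodule_def ..
qed

text \<open>
  The structure is forced because positive scalars are invertible: \<open>r m\<close> and \<open>m + m = 2 m\<close> are
  non-zero, hence equal to \<open>m\<close>.
\<close>

lemma two_element_iso_boolean:
  assumes "carrier M = {\<zero>, m}" "m \<noteq> \<zero>"
  shows "semimodule_isomorphic (nonneg_semiring K) M boolean_semimodule"
proof -
  have m: "m \<in> carrier M" using assms by simp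
  have act: "r \<odot> m = m" if "r \<in> K" "0 < r" for r
    using that act_closed[of r m] act_eq_zero_iff[of r m] m assms by auto
  have "m \<oplus> m = 2 \<odot> m" using act_add_left[of 1 1 m] m by simp
  also have "\<dots> = m" using act[of 2] add_mem[OF one_mem one_mem] by simp
  finally have mm: "m \<oplus> m = m" .
  let ?f = "\<lambda>x. x \<noteq> \<zero>"
  have "bij_betw ?f (carrier M) (carrier boolean_semimodule)"
    using assms by (auto simp: boolean_semimodule_def bij_betw_def inj_on_def)
  moreover have "?f \<in> semimodule_hom (nonneg_semiring K) M boolean_semimodule"
    using assms mm m act
    by (auto simp: semimodule_hom_def boolean_semimodule_def order.order_iff_strict)
  ultimately show ?thesis unfolding semimodule_isomorphic_def by blast
qed

section \<open>Minimal semimodules\<close>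

lemma minimal_cyclic:
  assumes "minimal_semimodule (nonneg_semiring K) M" "m \<in> carrier M" "m \<noteq> \<zero>" "x \<in> carrier M"
  obtains r where "r \<in> K" "0 \<le> r" "x = r \<odot> m"
proof -
  let ?N = "{r \<odot> m | r. r \<in> K \<and> 0 \<le> r}"
  have "subsemimodule ?N (nonneg_semiring K) M"
  proof (rule subsemimoduleI)
    show "\<zero> \<in> ?N" using assms(2) by (auto intro!: exI[of _ 0])
    show "x \<oplus> y \<in> ?N" if xy: "x \<in> ?N" "y \<in> ?N" for x y
    proof -
      from xy obtain r s where "r \<in> K" "0 \<le> r" "s \<in> K" "0 \<le> s" "x = r \<odot> m" "y = s \<odot> m" by blast
      then show ?thesis using act_add_left[of r s m] assms(2) add_mem[of r s]
        by (auto intro!: exI[of _ "r + s"])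
    qed
    show "r \<odot> x \<in> ?N" if r: "r \<in> K" "0 \<le> r" and x: "x \<in> ?N" for r x
    proof -
      from x obtain s where "s \<in> K" "0 \<le> s" "x = s \<odot> m" by blast
      then show ?thesis using act_mult[of r s m] assms(2) r
        by (auto intro!: exI[of _ "r * s"])
    qed
  qed (use assms in auto)
  moreover have "m \<in> ?N" using assms(2) by (auto intro!: exI[of _ 1])
  ultimately have "?N = carrier M"
    using assms(1,3) unfolding minimal_semimodule_def by blast
  with assms(4) that show thesis by blast
qed

text \<open>
  From \<open>m + (c - 1) m = m\<close> it follows that \<open>1 + n (c - 1)\<close> stabilises \<open>m\<close> for every \<open>n\<close>. Any
  \<open>r \<ge> 1\<close> is a convex combination of \<open>1\<close> and such a number, and convex combinations of
  stabilising scalars stabilise. Scalars below \<open>1\<close> are inverses of scalars above \<open>1\<close>.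
\<close>

lemma stabiliser_all:
  assumes m: "m \<in> carrier M" and c: "c \<in> K" "1 < c" "c \<odot> m = m" and r: "r \<in> K" "0 < r"
  shows "r \<odot> m = m"
proof -
  have step: "(1 + of_nat n * (c - 1)) \<odot> m = m" for n
  proof (induction n)
    case (Suc n)
    have "(1 + of_nat (Suc n) * (c - 1)) \<odot> m = ((1 + of_nat n * (c - 1)) + (c - 1)) \<odot> m"
      by (simp add: algebra_simps)
    also have "\<dots> = m \<oplus> (c - 1) \<odot> m"
      using act_add_left[of "1 + of_nat n * (c - 1)" "c - 1" m] c m Suc by simp
    also have "\<dots> = (1 + (c - 1)) \<odot> m"
      using act_add_left[of 1 "c - 1" m] c m by simp
    also have "\<dots> = m" using c by simp
    finally show ?case .
  qed (use m in simp)
  have above: "s \<odot> m = m" if s: "s \<in> K" "1 \<le> s" for s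
  proof (cases "s = 1")
    case False
    with s have s1: "1 < s" by simp
    obtain n where n: "s < of_nat n * (c - 1)"
      using reals_Archimedean3[of "c - 1"] c by auto
    \<comment> \<open>\<open>t\<close> is the weight with which \<open>s\<close> divides the segment from \<open>1\<close> to \<open>L\<close>.\<close>
    define L where "L = 1 + of_nat n * (c - 1)"
    define t where "t = (s - 1) / (L - 1)"
    have L: "L \<in> K" "s < L" "L \<odot> m = m" using n c step[of n] by (simp_all add: L_def)
    have t: "t \<in> K" "0 \<le> t" "t \<le> 1" using L s s1 by (simp_all add: t_def)
    have "t * (L - 1) = s - 1" using L s1 by (simp add: t_def)
    then have "s = (1 - t) + t * L" by (simp add: algebra_simps)
    then have "s \<odot> m = (1 - t) \<odot> m \<oplus> t \<odot> (L \<odot> m)"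
      using act_add_left[of "1 - t" "t * L" m] act_mult[of t L m] L t s1 m by simp
    also have "\<dots> = ((1 - t) + t) \<odot> m"
      using act_add_left[of "1 - t" t m] L t m by simp
    finally show ?thesis using m by simp
  qed (use m in simp)
  show ?thesis
  proof (cases "1 \<le> r")
    case False
    then have "inverse r \<odot> m = m" using above[of "inverse r"] r by (simp add: one_le_inverse)
    then show ?thesis using act_inverse(2)[OF r m] by simp
  qed (use above r in simp)
qed

lemma minimal_cases:
  assumes min: "minimal_semimodule (nonneg_semiring K) M" and m: "m \<in> carrier M" "m \<noteq> \<zero>"
  obtains (two_element) "carrier M = {\<zero>, m}"
  | (free) "inj_on (\<lambda>r. r \<odot> m) {r \<in> K. 0 \<le> r}"
proof (cases "inj_on (\<lambda>r. r \<odot> m) {r \<in> K. 0 \<le> r}")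
  case False
  then obtain r s where rs: "r \<in> K" "s \<in> K" "0 \<le> r" "r < s" "r \<odot> m = s \<odot> m"
    unfolding inj_on_def by (metis (mono_tags, lifting) linorder_neqE mem_Collect_eq)
  \<comment> \<open>For \<open>r = 0\<close> the invertible scalar \<open>s\<close> would annihilate \<open>m\<close>.\<close>
  have "r \<noteq> 0"
    using rs m act_eq_zero_iff[of s m] by auto
  with rs have r: "0 < r" by simp
  have "(s / r) \<odot> m = inverse r \<odot> (s \<odot> m)"
    using act_mult[of "inverse r" s m] rs r m by (simp add: field_simps)
  also have "\<dots> = m" using rs r m by (simp flip: rs(5))
  finally have c: "(s / r) \<odot> m = m" .
  \<comment> \<open>Every positive scalar now fixes \<open>m\<close>, which generates \<open>M\<close>.\<close>
  have "carrier M \<subseteq> {\<zero>, m}"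
  proof
    fix x assume "x \<in> carrier M"
    then obtain t where t: "t \<in> K" "0 \<le> t" "x = t \<odot> m" using minimal_cyclic[OF min m] by metis
    then show "x \<in> {\<zero>, m}"
      using stabiliser_all[OF m(1) _ _ c, of t] rs r m by (cases "t = 0") auto
  qed
  with m zero_closed have "carrier M = {\<zero>, m}" by auto
  then show thesis by (rule two_element)
qed (rule free)

lemma free_cyclic_iso_regular:
  assumes min: "minimal_semimodule (nonneg_semiring K) M" and m: "m \<in> carrier M" "m \<noteq> \<zero>"
    and inj: "inj_on (\<lambda>r. r \<odot> m) {r \<in> K. 0 \<le> r}"
  shows "semimodule_isomorphic (nonneg_semiring K) M (regular_semimodule (nonneg_semiring K))"
proof -
  let ?P = "{r \<in> K. 0 \<le> r}"
  define f where "f = the_inv_into ?P (\<lambda>r. r \<odot> m)"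
  have f: "f (r \<odot> m) = r" if "r \<in> K" "0 \<le> r" for r
    unfolding f_def using the_inv_into_f_f[OF inj] that by simp
  have surj: "\<exists>r. r \<in> K \<and> 0 \<le> r \<and> x = r \<odot> m" if "x \<in> carrier M" for x
    using minimal_cyclic[OF min m that] by blast
  have bij: "bij_betw f (carrier M) (carrier (regular_semimodule (nonneg_semiring K)))"
    by (rule bij_betw_byWitness[where f' = "\<lambda>r. r \<odot> m"])
      (use f surj m in \<open>fastforce simp: regular_semimodule_def\<close>)+
  have "f \<in> semimodule_hom (nonneg_semiring K) M (regular_semimodule (nonneg_semiring K))"
    unfolding semimodule_hom_def
  proof (intro CollectI conjI ballI)
    show "f \<in> carrier M \<rightarrow> carrier (regular_semimodule (nonneg_semiring K))"
      using bij by (auto simp: bij_betw_def)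
    show "f \<zero> = \<zero>\<^bsub>regular_semimodule (nonneg_semiring K)\<^esub>"
      using f[of 0] m by (simp add: regular_semimodule_def)
    fix x assume "x \<in> carrier M"
    then obtain r where r: "r \<in> K" "0 \<le> r" "x = r \<odot> m" using surj by blast
    show "f (x \<oplus> y) = f x \<oplus>\<^bsub>regular_semimodule (nonneg_semiring K)\<^esub> f y"
      if "y \<in> carrier M" for y
    proof -
      from that obtain s where s: "s \<in> K" "0 \<le> s" "y = s \<odot> m" using surj by blast
      show ?thesis using f[of "r + s"] f[of r] f[of s] act_add_left[of r s m] r s m
        by (simp add: regular_semimodule_def)
    qed
    show "f (s \<odot> x) = s \<odot>\<^bsub>regular_semimodule (nonneg_semiring K)\<^esub> f x"
      if "s \<in> carrier (nonneg_semiring K)" for s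
      using f[of "s * r"] f[of r] act_mult[of s r m] r that m
      by (simp add: regular_semimodule_def)
  qed
  with bij show ?thesis unfolding semimodule_isomorphic_def by blast
qed

text \<open>If \<open>- m\<close> were a multiple \<open>r m\<close>, the invertible scalar \<open>1 + r\<close> would annihilate \<open>m\<close>.\<close>

lemma minimal_not_group:
  assumes min: "minimal_semimodule (nonneg_semiring K) M" and m: "m \<in> carrier M" "m \<noteq> \<zero>"
    and y: "y \<in> carrier M"
  shows "m \<oplus> y \<noteq> \<zero>"
proof
  assume 0: "m \<oplus> y = \<zero>"
  obtain r where r: "r \<in> K" "0 \<le> r" "y = r \<odot> m" using minimal_cyclic[OF min m y] .
  then have "(1 + r) \<odot> m = \<zero>" using 0 act_add_left[of 1 r m] m by simp
  then show False using act_eq_zero_iff[of "1 + r" m] r m by simp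
qed

section \<open>Elementary semimodules\<close>

text \<open>
  The class of \<open>0\<close> is the group of additive units. So if this is the full relation, \<open>M\<close> is a group,
  and if it is equality, \<open>0\<close> is the only unit.
\<close>

lemma unit_congruence:
  "semimodule_congruence {(x, y). x \<in> carrier M \<and> y \<in> carrier M \<and>
     (\<exists>u v. u \<in> carrier M \<and> v \<in> carrier M \<and> u \<oplus> v = \<zero> \<and> x \<oplus> u = y)} (nonneg_semiring K) M"
proof (rule semimodule_congruenceI, goal_cases)
  case (1 x)
  then show ?case by (intro exI[of _ \<zero>]) simp
next
  case (2 x y)
  then obtain u v where u: "u \<in> carrier M" "v \<in> carrier M" "u \<oplus> v = \<zero>" "x \<oplus> u = y" by blast
  then have "y \<oplus> v = x" using 2 by (auto simp: a_assoc)
  then show ?case using u a_comm by metis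
next
  case (3 x y z)
  then obtain u v u' v' where u: "u \<in> carrier M" "v \<in> carrier M" "u \<oplus> v = \<zero>" "x \<oplus> u = y"
    "u' \<in> carrier M" "v' \<in> carrier M" "u' \<oplus> v' = \<zero>" "y \<oplus> u' = z" by blast
  have "(u \<oplus> u') \<oplus> (v \<oplus> v') = (u \<oplus> v) \<oplus> (u' \<oplus> v')"
    using u(1,2,5,6) by (simp add: a_ac)
  then have "(u \<oplus> u') \<oplus> (v \<oplus> v') = \<zero>" using u by simp
  moreover have "x \<oplus> (u \<oplus> u') = z" using u 3 by (auto simp: a_assoc)
  ultimately show ?case using u a_closed by blast
next
  case (4 x y k)
  then obtain u v where u: "u \<in> carrier M" "v \<in> carrier M" "u \<oplus> v = \<zero>" "x \<oplus> u = y" by blast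
  then have "x \<oplus> k \<oplus> u = y \<oplus> k" using 4 by (auto simp: a_ac)
  then show ?case using u by blast
next
  case (5 x y r)
  then obtain u v where u: "u \<in> carrier M" "v \<in> carrier M" "u \<oplus> v = \<zero>" "x \<oplus> u = y" by blast
  then have "r \<odot> u \<oplus> r \<odot> v = \<zero>" "r \<odot> x \<oplus> r \<odot> u = r \<odot> y"
    using 5 act_add_right[of r u v] act_add_right[of r x u] by auto
  then show ?case using u 5 act_closed by (metis less_imp_le)
qed

text \<open>
  The hypothesis says that \<open>0\<close> is the only additive unit. Then a sum vanishes only if both summands
  do, and a positive scalar, being invertible, kills no non-zero element.
\<close>

lemma zero_nonzero_congruence:
  assumes "\<And>x y. \<lbrakk>x \<in> carrier M; y \<in> carrier M; x \<oplus> y = \<zero>\<rbrakk> \<Longrightarrow> x = \<zero>"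
  shows "semimodule_congruence {(x, y). x \<in> carrier M \<and> y \<in> carrier M \<and> (x = \<zero> \<longleftrightarrow> y = \<zero>)}
    (nonneg_semiring K) M"
proof (rule semimodule_congruenceI, goal_cases)
  case (4 x y k)
  have "z \<oplus> k = \<zero> \<longleftrightarrow> z = \<zero> \<and> k = \<zero>" if "z \<in> carrier M" for z
    using assms[of z k] assms[of k z] that 4(3) a_comm[of z k] by auto
  with 4 show ?case by simp
qed (simp_all add: act_eq_zero_iff)

lemma elementary_cases:
  assumes el: "elementary_semimodule (nonneg_semiring K) M"
  obtains (two_element) m where "carrier M = {\<zero>, m}" "m \<noteq> \<zero>"
  | (group) "\<forall>x \<in> carrier M. \<exists>y \<in> carrier M. x \<oplus> y = \<zero>"
  using el unit_congruence
proof (cases rule: elementary_congruence_cases)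
  case total
  have "\<exists>y \<in> carrier M. x \<oplus> y = \<zero>" if x: "x \<in> carrier M" for x
    using total[OF zero_closed x] x by auto
  then show thesis by (intro group) blast
next
  case identity
  have zsf: "x = \<zero>" if xy: "x \<in> carrier M" "y \<in> carrier M" "x \<oplus> y = \<zero>" for x y
  proof -
    have "\<exists>u v. u \<in> carrier M \<and> v \<in> carrier M \<and> u \<oplus> v = \<zero> \<and> \<zero> \<oplus> u = x"
      using xy l_zero by blast
    then show ?thesis using identity[OF zero_closed xy(1)] by simp
  qed
  obtain m where m: "m \<in> carrier M" "m \<noteq> \<zero>"
    using el nonzero_exists unfolding elementary_semimodule_def by blast
  have "semimodule_congruence {(x, y). x \<in> carrier M \<and> y \<in> carrier M \<and> (x = \<zero> \<longleftrightarrow> y = \<zero>)}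
      (nonneg_semiring K) M"
    using zsf by (rule zero_nonzero_congruence)
  with el show thesis
  proof (cases rule: elementary_congruence_cases)
    case identity
    have "x = m" if "x \<in> carrier M" "x \<noteq> \<zero>" for x
      using identity[OF that(1) m(1)] that(2) m(2) by simp
    then have "carrier M = {\<zero>, m}" using m zero_closed by blast
    with m show thesis by (intro two_element)
  next
    case total
    from total[OF m(1) zero_closed] m(2) show thesis by simp
  qed
qed

text \<open>
  For a group \<open>M\<close> this is the congruence of the quotient by the line \<open>K m\<close>, written without
  subtraction. If it is the full relation, comparing \<open>x\<close> with \<open>0\<close> gives \<open>x + r m = s m\<close> for every
  \<open>x\<close>, so \<open>m\<close> spans.
\<close>

lemma line_congruence:
  assumes m: "m \<in> carrier M"
  shows "semimodule_congruence {(x, y). x \<in> carrier M \<and> y \<in> carrier M \<and>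
     (\<exists>r s. r \<in> K \<and> 0 \<le> r \<and> s \<in> K \<and> 0 \<le> s \<and> x \<oplus> r \<odot> m = y \<oplus> s \<odot> m)} (nonneg_semiring K) M"
proof (rule semimodule_congruenceI, goal_cases)
  case (1 x)
  show ?case by (intro exI[of _ 0]) simp
next
  case (2 x y)
  then show ?case by metis
next
  case (3 x y z)
  then obtain r s r' s' where r: "r \<in> K" "0 \<le> r" "s \<in> K" "0 \<le> s" "x \<oplus> r \<odot> m = y \<oplus> s \<odot> m"
    "r' \<in> K" "0 \<le> r'" "s' \<in> K" "0 \<le> s'" "y \<oplus> r' \<odot> m = z \<oplus> s' \<odot> m" by metis
  have "x \<oplus> (r + r') \<odot> m = (x \<oplus> r \<odot> m) \<oplus> r' \<odot> m"
    using r(1-4,6-9) 3(1-3) m act_add_left[of r r' m] by (simp add: a_assoc)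
  also have "\<dots> = (y \<oplus> r' \<odot> m) \<oplus> s \<odot> m"
    unfolding r(5) using r(1-4,6-9) 3(1-3) m by (simp add: a_ac)
  also have "\<dots> = z \<oplus> (s + s') \<odot> m"
    unfolding r(10) using r(1-4,6-9) 3(1-3) m act_add_left[of s s' m] by (simp add: a_ac)
  finally show ?case using r by (intro exI[of _ "r + r'"] exI[of _ "s + s'"]) simp
next
  case (4 x y k)
  then obtain r s where r: "r \<in> K" "0 \<le> r" "s \<in> K" "0 \<le> s" "x \<oplus> r \<odot> m = y \<oplus> s \<odot> m" by metis
  have "(x \<oplus> k) \<oplus> r \<odot> m = (x \<oplus> r \<odot> m) \<oplus> k" using r(1-4) 4(1-3) m by (simp add: a_ac)
  also have "\<dots> = (y \<oplus> k) \<oplus> s \<odot> m" unfolding r(5) using r(1-4) 4(1-3) m by (simp add: a_ac)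
  finally show ?case using r by metis
next
  case (5 x y t)
  then obtain r s where r: "r \<in> K" "0 \<le> r" "s \<in> K" "0 \<le> s" "x \<oplus> r \<odot> m = y \<oplus> s \<odot> m" by metis
  then have "t \<odot> (x \<oplus> r \<odot> m) = t \<odot> (y \<oplus> s \<odot> m)" by simp
  then have "t \<odot> x \<oplus> (t * r) \<odot> m = t \<odot> y \<oplus> (t * s) \<odot> m"
    using 5 r(1-4) m by (simp add: act_add_right act_mult)
  then show ?case using r 5 by (intro exI[of _ "t * r"] exI[of _ "t * s"]) simp
qed

text \<open>
  The isomorphism sends \<open>x\<close> to its coordinate \<open>s - r\<close>, where \<open>x + r m = s m\<close>. Since
  \<open>r \<mapsto> r m\<close> is injective in a group, the coordinate is unique; by cancellation it determines \<open>x\<close>.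
\<close>

lemma elementary_group_iso_field:
  assumes el: "elementary_semimodule (nonneg_semiring K) M"
    and group: "\<forall>x \<in> carrier M. \<exists>y \<in> carrier M. x \<oplus> y = \<zero>"
  shows "semimodule_isomorphic (nonneg_semiring K) M (field_semimodule K)"
proof -
  obtain m where m: "m \<in> carrier M" "m \<noteq> \<zero>"
    using el nonzero_exists unfolding elementary_semimodule_def by blast
  have cancel: "x = y"
    if xyz: "x \<in> carrier M" "y \<in> carrier M" "z \<in> carrier M" "x \<oplus> z = y \<oplus> z" for x y z
  proof -
    obtain w where w: "w \<in> carrier M" "z \<oplus> w = \<zero>" using group xyz by blast
    have "(x \<oplus> z) \<oplus> w = (y \<oplus> z) \<oplus> w" using xyz(4) by simp
    then show ?thesis using xyz(1-3) w by (simp add: a_assoc)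
  qed
  have free_less: "r \<odot> m \<noteq> s \<odot> m" if rs: "r \<in> K" "0 \<le> r" "s \<in> K" "r < s" for r s
  proof
    assume "r \<odot> m = s \<odot> m"
    then have "\<zero> \<oplus> r \<odot> m = (s - r) \<odot> m \<oplus> r \<odot> m"
      using act_add_left[of "s - r" r m] rs m by simp
    then have "\<zero> = (s - r) \<odot> m" by (rule cancel[rotated 3]) (use rs m in simp_all)
    then show False using act_eq_zero_iff[of "s - r" m] rs m by simp
  qed
  have free: "r = s" if "r \<in> K" "0 \<le> r" "s \<in> K" "0 \<le> s" "r \<odot> m = s \<odot> m" for r s
    using free_less[of r s] free_less[of s r] that by force
  \<comment> \<open>The relation that \<open>k\<close> is a coordinate of \<open>x\<close> along \<open>m\<close>; the homomorphism laws are easier to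
    see on the relation than on the function it defines.\<close>
  define C where "C x k \<longleftrightarrow>
    (\<exists>r s. r \<in> K \<and> 0 \<le> r \<and> s \<in> K \<and> 0 \<le> s \<and> x \<oplus> r \<odot> m = s \<odot> m \<and> k = s - r)" for x k
  have C_ex: "\<exists>k. C x k" if x: "x \<in> carrier M" for x
    using el line_congruence[OF m(1)]
  proof (cases rule: elementary_congruence_cases)
    case identity
    have "\<exists>r s. r \<in> K \<and> 0 \<le> r \<and> s \<in> K \<and> 0 \<le> s \<and> m \<oplus> r \<odot> m = \<zero> \<oplus> s \<odot> m"
      by (rule exI[of _ 0], rule exI[of _ 1]) (use m in simp)
    then have "m = \<zero>" using m by (intro identity) simp_all
    with m show ?thesis by simp
  next
    case total
    from total[OF x zero_closed] obtain r s
      where "r \<in> K" "0 \<le> r" "s \<in> K" "0 \<le> s" "x \<oplus> r \<odot> m = s \<odot> m" using m by auto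
    then show ?thesis unfolding C_def by blast
  qed
  have C_unique: "k = l" if x: "x \<in> carrier M" and kl: "C x k" "C x l" for x k l
  proof -
    from kl obtain r s r' s' where r: "r \<in> K" "0 \<le> r" "s \<in> K" "0 \<le> s" "x \<oplus> r \<odot> m = s \<odot> m" "k = s - r"
      "r' \<in> K" "0 \<le> r'" "s' \<in> K" "0 \<le> s'" "x \<oplus> r' \<odot> m = s' \<odot> m" "l = s' - r'" unfolding C_def by metis
    have "(s + r') \<odot> m = (x \<oplus> r \<odot> m) \<oplus> r' \<odot> m" using r m by (simp add: act_add_left)
    also have "\<dots> = (x \<oplus> r' \<odot> m) \<oplus> r \<odot> m" using r(1-4,7-10) x m by (simp add: a_ac)
    also have "\<dots> = (s' + r) \<odot> m" using r m by (simp add: act_add_left)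
    finally have "s + r' = s' + r" using r by (intro free) simp_all
    then show ?thesis using r by simp
  qed
  have C_inj: "x = y" if xy: "x \<in> carrier M" "y \<in> carrier M" and k: "C x k" "C y k" for x y k
  proof -
    from k obtain r s r' s' where r: "r \<in> K" "0 \<le> r" "s \<in> K" "0 \<le> s" "x \<oplus> r \<odot> m = s \<odot> m" "k = s - r"
      "r' \<in> K" "0 \<le> r'" "s' \<in> K" "0 \<le> s'" "y \<oplus> r' \<odot> m = s' \<odot> m" "k = s' - r'" unfolding C_def by metis
    have eq: "s + r' = s' + r" using r by simp
    have "x \<oplus> (r + r') \<odot> m = (x \<oplus> r \<odot> m) \<oplus> r' \<odot> m"
      using r(1-4,7-10) xy m by (simp add: act_add_left a_assoc)
    also have "\<dots> = (s + r') \<odot> m" using r m by (simp add: act_add_left)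
    also have "\<dots> = (y \<oplus> r' \<odot> m) \<oplus> r \<odot> m" unfolding eq using r m by (simp add: act_add_left)
    also have "\<dots> = y \<oplus> (r + r') \<odot> m"
      using r(1-4,7-10) xy m by (simp add: act_add_left a_ac)
    finally show ?thesis by (rule cancel[rotated 3]) (use r xy m in simp_all)
  qed
  have C_add: "C (x \<oplus> y) (k + l)" if xy: "x \<in> carrier M" "y \<in> carrier M" and kl: "C x k" "C y l" for x y k l
  proof -
    from kl obtain r s r' s' where r: "r \<in> K" "0 \<le> r" "s \<in> K" "0 \<le> s" "x \<oplus> r \<odot> m = s \<odot> m" "k = s - r"
      "r' \<in> K" "0 \<le> r'" "s' \<in> K" "0 \<le> s'" "y \<oplus> r' \<odot> m = s' \<odot> m" "l = s' - r'" unfolding C_def by metis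
    have "(x \<oplus> y) \<oplus> (r + r') \<odot> m = (x \<oplus> r \<odot> m) \<oplus> (y \<oplus> r' \<odot> m)"
      using r(1-4,7-10) xy m by (simp add: act_add_left a_ac)
    also have "\<dots> = (s + s') \<odot> m" using r m by (simp add: act_add_left)
    finally show ?thesis unfolding C_def using r
      by (intro exI[of _ "r + r'"] exI[of _ "s + s'"]) simp
  qed
  have C_act: "C (t \<odot> x) (t * k)" if x: "x \<in> carrier M" and t: "t \<in> K" "0 \<le> t" and k: "C x k" for x t k
  proof -
    from k obtain r s where r: "r \<in> K" "0 \<le> r" "s \<in> K" "0 \<le> s" "x \<oplus> r \<odot> m = s \<odot> m" "k = s - r"
      unfolding C_def by metis
    have "t \<odot> (x \<oplus> r \<odot> m) = t \<odot> (s \<odot> m)" using r by simp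
    then have "t \<odot> x \<oplus> (t * r) \<odot> m = (t * s) \<odot> m"
      using x t r(1-4) m by (simp add: act_add_right act_mult)
    then show ?thesis unfolding C_def using r t
      by (intro exI[of _ "t * r"] exI[of _ "t * s"]) (simp add: right_diff_distrib)
  qed
  have C_mem: "k \<in> K" if "C x k" for x k
    using that unfolding C_def by auto
  have C_surj: "\<exists>x \<in> carrier M. C x k" if k: "k \<in> K" for k
  proof (cases "0 \<le> k")
    case True
    then show ?thesis unfolding C_def using k m
      by (intro bexI[of _ "k \<odot> m"] exI[of _ 0] exI[of _ k]) simp_all
  next
    case False
    have "(- k) \<odot> m \<in> carrier M" using k m False by simp
    then obtain w where "w \<in> carrier M" "(- k) \<odot> m \<oplus> w = \<zero>" using group by blast
    then show ?thesis unfolding C_def using k m False a_comm[of w "(- k) \<odot> m"]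
      by (intro bexI[of _ w] exI[of _ "- k"] exI[of _ 0]) simp_all
  qed
  define f where "f x = (THE k. C x k)" for x
  have C_f: "C x (f x)" if x: "x \<in> carrier M" for x
  proof -
    obtain k where k: "C x k" using C_ex[OF x] by blast
    then show ?thesis unfolding f_def by (rule theI) (rule C_unique[OF x _ k])
  qed
  have f_eq: "f x = k" if "x \<in> carrier M" "C x k" for x k
    using C_unique[OF that(1) C_f[OF that(1)] that(2)] .
  have "bij_betw f (carrier M) (carrier (field_semimodule K))"
    unfolding bij_betw_def
  proof
    show "inj_on f (carrier M)" using C_f C_inj by (intro inj_onI) metis
    show "f ` carrier M = carrier (field_semimodule K)"
    proof
      show "f ` carrier M \<subseteq> carrier (field_semimodule K)"
        using C_mem[OF C_f] by (auto simp: field_semimodule_def)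
      show "carrier (field_semimodule K) \<subseteq> f ` carrier M"
      proof
        fix k assume "k \<in> carrier (field_semimodule K)"
        then obtain x where "x \<in> carrier M" "C x k" using C_surj by (auto simp: field_semimodule_def)
        then show "k \<in> f ` carrier M" using f_eq by blast
      qed
    qed
  qed
  moreover have "f \<in> semimodule_hom (nonneg_semiring K) M (field_semimodule K)"
    unfolding semimodule_hom_def
  proof (intro CollectI conjI ballI)
    show "f \<in> carrier M \<rightarrow> carrier (field_semimodule K)"
      using C_mem[OF C_f] by (auto simp: field_semimodule_def)
    have "C \<zero> 0" unfolding C_def using m by (intro exI[of _ 0]) simp
    then show "f \<zero> = \<zero>\<^bsub>field_semimodule K\<^esub>" using f_eq by (simp add: field_semimodule_def)
    fix x assume x: "x \<in> carrier M"
    show "f (x \<oplus> y) = f x \<oplus>\<^bsub>field_semimodule K\<^esub> f y" if "y \<in> carrier M" for y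
      using f_eq[OF _ C_add[OF x that C_f[OF x] C_f[OF that]]] x that
      by (simp add: field_semimodule_def)
    show "f (r \<odot> x) = r \<odot>\<^bsub>field_semimodule K\<^esub> f x" if "r \<in> carrier (nonneg_semiring K)" for r
      using f_eq[OF _ C_act[OF x _ _ C_f[OF x], of r]] x that by (simp add: field_semimodule_def)
  qed
  ultimately show ?thesis unfolding semimodule_isomorphic_def by blast
qed

section \<open>Simple semimodules\<close>

lemma simple_two_element:
  assumes "simple_semimodule (nonneg_semiring K) M"
  obtains m where "carrier M = {\<zero>, m}" "m \<noteq> \<zero>"
proof -
  have min: "minimal_semimodule (nonneg_semiring K) M"
    and el: "elementary_semimodule (nonneg_semiring K) M"
    using assms unfolding simple_semimodule_def by auto
  obtain m where m: "m \<in> carrier M" "m \<noteq> \<zero>"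
    using el nonzero_exists unfolding elementary_semimodule_def by blast
  from el show thesis
  proof (cases rule: elementary_cases)
    case group
    with m obtain y where "y \<in> carrier M" "m \<oplus> y = \<zero>" by blast
    then show thesis using minimal_not_group[OF min m] by simp
  qed (rule that)
qed

end

section \<open>The three models\<close>

context real_subfield
begin

lemma semimodule_boolean: "nonneg_semimodule K boolean_semimodule"
proof -
  interpret S: semiring "nonneg_semiring K" by (rule semiring_nonneg)
  show ?thesis
    by unfold_locales (auto simp: boolean_semimodule_def Units_def)
qed

lemma semimodule_regular: "nonneg_semimodule K (regular_semimodule (nonneg_semiring K))"
proof -
  interpret S: semiring "nonneg_semiring K" by (rule semiring_nonneg)
  show ?thesis
    by unfold_locales (auto simp: regular_semimodule_def algebra_simps)
qed

lemma semimodule_field: "nonneg_semimodule K (field_semimodule K)"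
proof -
  interpret S: semiring "nonneg_semiring K" by (rule semiring_nonneg)
  show ?thesis
    by unfold_locales (auto simp: field_semimodule_def algebra_simps)
qed

lemma boolean_simple: "simple_semimodule (nonneg_semiring K) boolean_semimodule"
proof -
  interpret nonneg_semimodule K boolean_semimodule by (rule semimodule_boolean)
  show ?thesis
    by (rule two_element_simple[of True]) (auto simp: boolean_semimodule_def)
qed

lemma regular_minimal: "minimal_semimodule (nonneg_semiring K) (regular_semimodule (nonneg_semiring K))"
proof -
  let ?M = "regular_semimodule (nonneg_semiring K)"
  interpret nonneg_semimodule K ?M by (rule semimodule_regular)
  have [simp]: "carrier ?M = {r \<in> K. 0 \<le> r}" "\<zero>\<^bsub>?M\<^esub> = 0" "r \<odot>\<^bsub>?M\<^esub> x = r * x" for r x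
    by (simp_all add: regular_semimodule_def)
  show ?thesis
    unfolding minimal_semimodule_def
  proof (intro conjI allI impI)
    have "1 \<in> carrier ?M" "1 \<notin> {\<zero>\<^bsub>?M\<^esub>}" by simp_all
    then show "carrier ?M \<noteq> {\<zero>\<^bsub>?M\<^esub>}" by blast
    fix N assume N: "subsemimodule N (nonneg_semiring K) ?M"
    note N' = subsemimoduleD[OF N]
    show "N = {\<zero>\<^bsub>?M\<^esub>} \<or> N = carrier ?M"
    proof (cases "N \<subseteq> {0}")
      case False
      then obtain n where n: "n \<in> N" "n \<noteq> 0" by blast
      with N' have n': "n \<in> K" "0 < n" by auto
      have "r \<in> N" if "r \<in> K" "0 \<le> r" for r
        using N'(3)[of "r / n" n] that n n' by simp
      with N'(1) show ?thesis by auto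
    qed (use N' in auto)
  qed (rule semimodule_axioms)
qed

lemma regular_not_simple: "\<not> simple_semimodule (nonneg_semiring K) (regular_semimodule (nonneg_semiring K))"
proof
  let ?M = "regular_semimodule (nonneg_semiring K)"
  interpret nonneg_semimodule K ?M by (rule semimodule_regular)
  assume "simple_semimodule (nonneg_semiring K) ?M"
  then obtain m where "carrier ?M = {\<zero>\<^bsub>?M\<^esub>, m}" by (rule simple_two_element)
  then have "{r \<in> K. 0 \<le> r} = {0, m}" by (simp add: regular_semimodule_def)
  moreover have "1 \<in> {r \<in> K. 0 \<le> r}" "1 + 1 \<in> {r \<in> K. 0 \<le> r}"
    using add_mem[OF one_mem one_mem] by simp_all
  ultimately show False by auto
qed

text \<open>
  If \<open>a < b\<close> are congruent, translating by \<open>- a\<close> and scaling identify \<open>0\<close> with every non-negative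
  element; translating once more reaches the negative ones.
\<close>

lemma field_elementary: "elementary_semimodule (nonneg_semiring K) (field_semimodule K)"
proof -
  let ?M = "field_semimodule K"
  interpret nonneg_semimodule K ?M by (rule semimodule_field)
  have [simp]: "carrier ?M = K" "\<zero>\<^bsub>?M\<^esub> = 0" "r \<odot>\<^bsub>?M\<^esub> x = r * x" "x \<oplus>\<^bsub>?M\<^esub> y = x + y" for r x y
    by (simp_all add: field_semimodule_def)
  show ?thesis
    unfolding elementary_semimodule_def
  proof (intro conjI allI impI)
    have "1 \<in> carrier ?M" "1 \<notin> {\<zero>\<^bsub>?M\<^esub>}" by simp_all
    then show "carrier ?M \<noteq> {\<zero>\<^bsub>?M\<^esub>}" by blast
    fix E assume "semimodule_congruence E (nonneg_semiring K) ?M"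
    then have E: "refl_on K E" "sym E" "trans E" "E \<subseteq> K \<times> K"
      and shift: "\<And>x y k. \<lbrakk>(x, y) \<in> E; k \<in> K\<rbrakk> \<Longrightarrow> (x + k, y + k) \<in> E"
      and scale: "\<And>x y r. \<lbrakk>(x, y) \<in> E; r \<in> K; 0 \<le> r\<rbrakk> \<Longrightarrow> (r * x, r * y) \<in> E"
      unfolding semimodule_congruence_def equiv_def by auto
    show "E = Id_on (carrier ?M) \<or> E = carrier ?M \<times> carrier ?M"
    proof (cases "\<exists>a b. (a, b) \<in> E \<and> a < b")
      case True
      then obtain a b where ab: "(a, b) \<in> E" "a < b" by blast
      with E have K: "a \<in> K" "b \<in> K" by auto
      have base: "(0, b - a) \<in> E" using shift[OF ab(1), of "- a"] K by simp
      have nonneg: "(0, p) \<in> E" if "p \<in> K" "0 \<le> p" for p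
        using scale[OF base, of "p / (b - a)"] that ab K by simp
      have all: "(0, p) \<in> E" if p: "p \<in> K" for p
      proof (cases "0 \<le> p")
        case False
        then have "(p, 0) \<in> E" using shift[OF nonneg[of "- p"], of p] p by simp
        then show ?thesis using E by (auto dest: symD)
      qed (use nonneg p in simp)
      have "(x, y) \<in> E" if "x \<in> K" "y \<in> K" for x y
        using all[OF that(1)] all[OF that(2)] E by (meson symD transD)
      with E show ?thesis by auto
    next
      case False
      then have "a = b" if "(a, b) \<in> E" for a b
        using that E by (metis linorder_neqE symD)
      with E have "E = Id_on K" by (auto simp: refl_on_def)
      then show ?thesis by simp
    qed
  qed (rule semimodule_axioms)
qed

lemma field_not_simple: "\<not> simple_semimodule (nonneg_semiring K) (field_semimodule K)"
proof
  let ?M = "field_semimodule K"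
  interpret nonneg_semimodule K ?M by (rule semimodule_field)
  assume "simple_semimodule (nonneg_semiring K) ?M"
  then have "minimal_semimodule (nonneg_semiring K) ?M" unfolding simple_semimodule_def ..
  from minimal_not_group[OF this, of 1 "- 1"] show False
    using uminus_mem[OF one_mem] by (simp add: field_semimodule_def)
qed

end

section \<open>The classification\<close>

theorem theorem6p2:
  fixes K :: "real set"
  assumes "subfield K ring_of_type_algebra"
  shows
    "(simple_semimodule (nonneg_semiring K) boolean_semimodule \<and>
      (\<forall>M :: (real, 'm) module. simple_semimodule (nonneg_semiring K) M \<longrightarrow>
         semimodule_isomorphic (nonneg_semiring K) M boolean_semimodule)) \<and>
     (minimal_semimodule (nonneg_semiring K) (regular_semimodule (nonneg_semiring K)) \<and>
      \<not> simple_semimodule (nonneg_semiring K) (regular_semimodule (nonneg_semiring K)) \<and>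
      (\<forall>M :: (real, 'm) module. minimal_semimodule (nonneg_semiring K) M \<and> \<not> simple_semimodule (nonneg_semiring K) M \<longrightarrow>
         semimodule_isomorphic (nonneg_semiring K) M (regular_semimodule (nonneg_semiring K)))) \<and>
     (elementary_semimodule (nonneg_semiring K) (field_semimodule K) \<and>
      \<not> simple_semimodule (nonneg_semiring K) (field_semimodule K) \<and>
      (\<forall>M :: (real, 'm) module. elementary_semimodule (nonneg_semiring K) M \<and> \<not> simple_semimodule (nonneg_semiring K) M \<longrightarrow>
         semimodule_isomorphic (nonneg_semiring K) M (field_semimodule K)))"
proof -
  interpret F: real_subfield K using assms by (rule real_subfield.intro)
  let ?R = "nonneg_semiring K"
  have N: "nonneg_semimodule K M" if "semimodule ?R M" for M :: "(real, 'm) module"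
    using that F.real_subfield_axioms by (simp add: nonneg_semimodule_def)
  have boolean: "semimodule_isomorphic ?R M boolean_semimodule"
    if simple: "simple_semimodule ?R M" for M :: "(real, 'm) module"
  proof -
    interpret nonneg_semimodule K M
      using N simple unfolding simple_semimodule_def minimal_semimodule_def by blast
    show ?thesis using simple_two_element[OF simple] two_element_iso_boolean by blast
  qed
  have regular: "semimodule_isomorphic ?R M (regular_semimodule ?R)"
    if min: "minimal_semimodule ?R M" and not_simple: "\<not> simple_semimodule ?R M"
    for M :: "(real, 'm) module"
  proof -
    interpret nonneg_semimodule K M using N min unfolding minimal_semimodule_def by blast
    obtain m where m: "m \<in> carrier M" "m \<noteq> \<zero>\<^bsub>M\<^esub>"
      using min nonzero_exists unfolding minimal_semimodule_def by blast
    from min m show ?thesis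
    proof (cases rule: minimal_cases)
      case two_element
      then show ?thesis using two_element_simple m not_simple by blast
    next
      case free
      then show ?thesis by (rule free_cyclic_iso_regular[OF min m])
    qed
  qed
  have field: "semimodule_isomorphic ?R M (field_semimodule K)"
    if el: "elementary_semimodule ?R M" and not_simple: "\<not> simple_semimodule ?R M"
    for M :: "(real, 'm) module"
  proof -
    interpret nonneg_semimodule K M using N el unfolding elementary_semimodule_def by blast
    from el show ?thesis
    proof (cases rule: elementary_cases)
      case two_element
      then show ?thesis using two_element_simple not_simple by blast
    next
      case group
      then show ?thesis by (rule elementary_group_iso_field[OF el])
    qed
  qed
  show ?thesis
    using boolean regular field F.boolean_simple F.regular_minimal F.regular_not_simple
      F.field_elementary F.field_not_simple
    by blast
qed

end
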